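(* Let $r$ be a positive integer, let $n\ge 2r$, and let $P$ be a set of $n$ (distinct) points on the moment curve $\gamma_{2r}$ in $\mathbb{R}^{2r}$. Then $$b_{2r}(P)\ \ge\ \sum_{\ell=1}^{n-2r+1}\frac{1}{\ell}\binom{n-\ell-r+1}{r}.$$ In particular, $$b_{2r}(P)\ \ge\ \frac{1}{r!}n^r\log n-O_r(n^r).$$
   Context: The moment curve in $\mathbb{R}^d$ is the image of $\gamma_d(t)=(t,t^2,\dots,t^d)$, $t\in\mathbb{R}$. A finite set $P\subset\mathbb{R}^d$ is in general position if every subset of at most $d+1$ points is affinely independent (sets of distinct points on the moment curve satisfy this). For $P\subset\mathbb{R}^d$ in general position, $b_d(P)$ is the minimum of $|Q|$ over all sets $Q\subset\mathbb{R}^d\setminus P$ such that $Q\cap\operatorname{relint}\operatorname{conv}(A)\ne\emptyset$ for every $d$-element subset $A\subseteq P$. The logarithm is natural. The notation $O_r(n^r)$ denotes a quantity bounded in absolute value by $C_r n^r$, where $C_r$ depends only on $r$ (not on $n$ or $P$). *)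

theory Defs
  imports "HOL-Analysis.Analysis"
begin

(* The linear order on the index type numbers the coordinates: card {..i} is the
   position of i counted from 1, so the coordinates of the curve are
   t, t^2, ..., t^CARD('n) in this order. *)
definition moment_curve :: "real \<Rightarrow> real ^ 'n::{finite,linorder}" where
  "moment_curve t = (\<chi> i. t ^ card {..i})"

lemma bij_betw_card_atMost:
  "bij_betw (\<lambda>i. card {..i}) (UNIV :: 'n::{finite,linorder} set) {1..CARD('n)}"
proof -
  have inj: "inj (\<lambda>i::'n. card {..i})"
  proof (rule linorder_injI)
    fix x y :: 'n
    assume "x < y"
    then have "{..x} \<subset> {..y}" by auto
    then show "card {..x} \<noteq> card {..y}"
      using psubset_card_mono[of "{..y}" "{..x}"] by simp
  qed
  have "range (\<lambda>i::'n. card {..i}) \<subseteq> {1..CARD('n)}"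
    by (auto simp: Suc_le_eq card_gt_0_iff intro!: card_mono)
  moreover have "card (range (\<lambda>i::'n. card {..i})) = card {1..CARD('n)}"
    using inj by (simp add: card_image)
  ultimately have "range (\<lambda>i::'n. card {..i}) = {1..CARD('n)}"
    by (intro card_subset_eq) auto
  with inj show ?thesis by (simp add: bij_betw_def)
qed

definition blocks :: "'a::euclidean_space set \<Rightarrow> 'a set \<Rightarrow> bool" where
  "blocks Q P \<longleftrightarrow> Q \<inter> P = {} \<and>
     (\<forall>A\<subseteq>P. card A = DIM('a) \<longrightarrow> Q \<inter> rel_interior (convex hull A) \<noteq> {})"

(* Intended for P finite and in general position and DIM('a) \<ge> 2; then finite blocking
   sets exist and the infimum is a minimum.  Finiteness of Q is required because card
   is 0 on infinite sets. *)
definition blocking_number :: "'a::euclidean_space set \<Rightarrow> nat" where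
  "blocking_number P = Inf {card Q | Q. finite Q \<and> blocks Q P}"

end

theory Submission
  imports Defs "HOL-Computational_Algebra.Polynomial"
begin

text \<open>
  Number the points along the curve and consider the \<open>2r\<close>-subsets that consist of a pair
  \<open>{i, i + l}\<close> followed by \<open>r - 1\<close> pairs of neighbours, each given the weight \<open>1 / l\<close>. There are
  \<open>(n - l - r + 1) choose r\<close> of them for each \<open>l\<close>, as one sees by contracting the pairs.
  Suppose that \<open>q\<close> lies in the relative interiors of the hulls of two such sets \<open>A \<noteq> B\<close>. The polynomial
  with root set \<open>A\<close> has degree \<open>2r\<close>, so its mean under the barycentric weights of \<open>q\<close> in \<open>B\<close> equals
  that in \<open>A\<close>, which is \<open>0\<close>; hence it is negative somewhere on \<open>B\<close>, which can only happen strictly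
  inside the long pair of \<open>A\<close>. By symmetry the long pairs of \<open>A\<close> and \<open>B\<close> cross. Among \<open>k\<close> pairwise
  crossing pairs all have length at least \<open>k\<close>, so a single point hits total weight at most \<open>1\<close>.
\<close>

section \<open>Polynomials and the moment curve\<close>

text \<open>The affine functional that agrees with \<open>p\<close> along the curve as long as
  \<open>degree p\<close> does not exceed the dimension: coordinate \<open>i\<close> stands in for
  the monomial of degree \<open>card {..i}\<close>.\<close>

definition moment_eval :: "real poly \<Rightarrow> real ^ 'n::{finite,linorder} \<Rightarrow> real" where
  "moment_eval p x = coeff p 0 + (\<Sum>i\<in>UNIV. coeff p (card {..i}) * x $ i)"

lemma moment_eval_moment_curve:
  assumes "degree p \<le> CARD('n::{finite,linorder})"
  shows "moment_eval p (moment_curve t :: (real, 'n) vec) = poly p t"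
proof -
  have "poly p t = (\<Sum>k\<le>CARD('n). coeff p k * t ^ k)"
    using assms unfolding poly_altdef
    by (intro sum.mono_neutral_left) (auto intro: coeff_eq_0)
  also have "\<dots> = coeff p 0 + (\<Sum>k=1..CARD('n). coeff p k * t ^ k)"
    by (simp add: atMost_atLeast0 sum.atLeast_Suc_atMost)
  also have "(\<Sum>k=1..CARD('n). coeff p k * t ^ k)
      = (\<Sum>i\<in>(UNIV :: 'n set). coeff p (card {..i}) * t ^ card {..i})"
    by (rule sum.reindex_bij_betw[OF bij_betw_card_atMost, symmetric])
  finally show ?thesis
    by (simp add: moment_eval_def moment_curve_def)
qed

text \<open>The coefficients may have any sum, so that this covers affine dependences (sum 0) as
  well as barycentric weights (sum 1).\<close>

lemma moment_eval_sum:
  "moment_eval p (\<Sum>x\<in>X. u x *\<^sub>R f x)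
    = (1 - sum u X) * coeff p 0 + (\<Sum>x\<in>X. u x * moment_eval p (f x))"
proof -
  have "(\<Sum>i\<in>UNIV. coeff p (card {..i}) * (\<Sum>x\<in>X. u x * f x $ i))
      = (\<Sum>x\<in>X. \<Sum>i\<in>UNIV. u x * (coeff p (card {..i}) * f x $ i))"
    by (subst sum.swap) (simp add: sum_distrib_left mult_ac)
  then show ?thesis
    by (simp add: moment_eval_def algebra_simps sum.distrib sum_distrib_left sum_distrib_right)
qed

lemma inj_moment_curve: "inj (moment_curve :: real \<Rightarrow> real ^ 'n::{finite,linorder})"
proof (rule injI)
  fix s t :: real
  assume eq: "(moment_curve s :: (real, 'n) vec) = moment_curve t"
  have deg: "degree [:0, 1::real:] \<le> CARD('n)"
    by (simp add: Suc_le_eq)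
  have "poly [:0, 1:] s = poly [:0, 1:] t"
    unfolding moment_eval_moment_curve[OF deg, symmetric] eq ..
  then show "s = t" by simp
qed

lemma degree_prod_linear: "degree (\<Prod>x\<in>X. [:- x, 1::real:]) \<le> card X"
proof (cases "finite X")
  case True
  then show ?thesis
  proof (induction X rule: finite_induct)
    case (insert x X)
    have "degree ([:- x, 1:] * (\<Prod>x\<in>X. [:- x, 1::real:])) \<le> 1 + degree (\<Prod>x\<in>X. [:- x, 1::real:])"
      by (rule order_trans[OF degree_mult_le]) simp
    with insert show ?case by simp
  qed simp
qed simp

text \<open>Lagrange's argument: a polynomial vanishing at all parameters except \<open>a\<close>
  has degree at most the dimension, so applying it to an affine dependence isolates the coefficient
  at \<open>a\<close>, which must then be 0.\<close>

lemma affine_independent_moment_curve: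
  assumes "finite X" and "card X \<le> CARD('n) + 1"
  shows "\<not> affine_dependent ((moment_curve :: real \<Rightarrow> real ^ 'n::{finite,linorder}) ` X)"
proof
  let ?\<gamma> = "moment_curve :: real \<Rightarrow> (real, 'n) vec"
  assume "affine_dependent (?\<gamma> ` X)"
  then obtain U where U: "sum U (?\<gamma> ` X) = 0" "\<exists>v\<in>?\<gamma> ` X. U v \<noteq> 0"
      "(\<Sum>v\<in>?\<gamma> ` X. U v *\<^sub>R v) = 0"
    using assms(1) by (auto simp: affine_dependent_explicit_finite)
  have inj: "inj_on ?\<gamma> X" using inj_moment_curve by (rule inj_on_subset) simp
  define u where "u = U \<circ> ?\<gamma>"
  have u0: "sum u X = 0" and u1: "(\<Sum>x\<in>X. u x *\<^sub>R ?\<gamma> x) = 0"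
    using U(1,3) by (simp_all add: u_def sum.reindex[OF inj])
  from U(2) obtain a where a: "a \<in> X" "u a \<noteq> 0" by (auto simp: u_def)
  define p where "p = (\<Prod>x\<in>X - {a}. [:- x, 1::real:])"
  have deg: "degree p \<le> CARD('n)"
    using degree_prod_linear[of "X - {a}"] a(1) assms by (simp add: p_def)
  have "0 = moment_eval p (\<Sum>x\<in>X. u x *\<^sub>R ?\<gamma> x) - coeff p 0"
    by (simp add: u1 moment_eval_def)
  also have "\<dots> = (\<Sum>x\<in>X. u x * poly p x)"
    by (simp add: moment_eval_sum u0 moment_eval_moment_curve[OF deg])
  also have "\<dots> = (\<Sum>x\<in>{a}. u x * poly p x)"
    using a(1) assms(1) by (intro sum.mono_neutral_right) (auto simp: p_def poly_prod)
  finally show False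
    using a assms(1) by (simp add: p_def poly_prod)
qed

text \<open>By affine independence the relative interior consists of the points with strictly
  positive barycentric weights. These weights form a quadrature rule whose value depends on
  \<open>q\<close> alone, so rules on different node sets can be compared.\<close>

lemma rel_interior_moment_curve:
  fixes q :: "real ^ 'n::{finite,linorder}"
  assumes "finite X" and "card X \<le> CARD('n) + 1"
    and "q \<in> rel_interior (convex hull (moment_curve ` X))"
  obtains u where "\<And>x. x \<in> X \<Longrightarrow> 0 < u x"
    and "\<And>p. degree p \<le> CARD('n) \<Longrightarrow> moment_eval p q = (\<Sum>x\<in>X. u x * poly p x)"
proof -
  let ?\<gamma> = "moment_curve :: real \<Rightarrow> (real, 'n) vec"
  have inj: "inj_on ?\<gamma> X" using inj_moment_curve by (rule inj_on_subset) simp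
  have "q \<in> {y. \<exists>U. (\<forall>v\<in>?\<gamma> ` X. 0 < U v) \<and> sum U (?\<gamma> ` X) = 1
      \<and> (\<Sum>v\<in>?\<gamma> ` X. U v *\<^sub>R v) = y}"
    using assms(3)
    unfolding rel_interior_convex_hull_explicit[OF affine_independent_moment_curve[OF assms(1,2)]] .
  then obtain U where U: "\<forall>v\<in>?\<gamma> ` X. 0 < U v" "sum U (?\<gamma> ` X) = 1"
      "(\<Sum>v\<in>?\<gamma> ` X. U v *\<^sub>R v) = q"
    by blast
  define u where "u = U \<circ> ?\<gamma>"
  have u1: "sum u X = 1" and q: "q = (\<Sum>x\<in>X. u x *\<^sub>R ?\<gamma> x)"
    using U(2,3) by (simp_all add: u_def sum.reindex[OF inj])
  show thesis
  proof (rule that)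
    show "0 < u x" if "x \<in> X" for x
      using U(1) that by (simp add: u_def)
    show "moment_eval p q = (\<Sum>x\<in>X. u x * poly p x)" if "degree p \<le> CARD('n)" for p
      unfolding q moment_eval_sum u1 moment_eval_moment_curve[OF that] by simp
  qed
qed

text \<open>If the polynomial with root set \<open>X\<close> were nonnegative on \<open>Y\<close>,
  its zero mean under positive weights would make it vanish on \<open>Y\<close>. Then
  \<open>Y\<close> lies in \<open>X\<close>, and equal cardinalities give
  \<open>X = Y\<close>.\<close>

lemma rel_interiors_meet_imp_prod_neg:
  fixes q :: "real ^ 'n::{finite,linorder}"
  assumes X: "finite X" "card X \<le> CARD('n)" "q \<in> rel_interior (convex hull (moment_curve ` X))"
    and Y: "finite Y" "card Y = card X" "q \<in> rel_interior (convex hull (moment_curve ` Y))"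
    and "X \<noteq> Y"
  shows "\<exists>y\<in>Y. (\<Prod>x\<in>X. y - x) < 0"
proof (rule ccontr)
  assume "\<not> ?thesis"
  then have nonneg: "0 \<le> (\<Prod>x\<in>X. y - x)" if "y \<in> Y" for y
    using that by (auto simp: not_less)
  define p where "p = (\<Prod>x\<in>X. [:- x, 1::real:])"
  have poly_p: "poly p y = (\<Prod>x\<in>X. y - x)" for y
    by (simp add: p_def poly_prod)
  have deg: "degree p \<le> CARD('n)"
    using degree_prod_linear[of X] X(2) by (simp add: p_def)
  have card_X: "card X \<le> CARD('n) + 1" and card_Y: "card Y \<le> CARD('n) + 1"
    using X(2) Y(2) by simp_all
  obtain u where u: "moment_eval p q = (\<Sum>x\<in>X. u x * poly p x)"
    by (rule rel_interior_moment_curve[OF X(1) card_X X(3)]) (use deg in blast)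
  obtain w where w: "\<And>y. y \<in> Y \<Longrightarrow> 0 < w y" "moment_eval p q = (\<Sum>y\<in>Y. w y * poly p y)"
    by (rule rel_interior_moment_curve[OF Y(1) card_Y Y(3)]) (use deg in blast)
  have "(\<Sum>x\<in>X. u x * poly p x) = 0"
    using X(1) by (intro sum.neutral) (auto simp: poly_p)
  then have "(\<Sum>y\<in>Y. w y * poly p y) = 0" using u w(2) by metis
  moreover have "0 \<le> w y * poly p y" if "y \<in> Y" for y
    using nonneg[OF that] w(1)[OF that] by (simp add: poly_p)
  ultimately have "\<forall>y\<in>Y. w y * poly p y = 0"
    using Y(1) sum_nonneg_eq_0_iff[of Y "\<lambda>y. w y * poly p y"] by metis
  then have "Y \<subseteq> X"
    using w(1) X(1) unfolding poly_p by (metis less_irrefl mult_eq_0_iff prod_zero_iff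
        right_minus_eq subsetI)
  then have "Y = X"
    using X(1) Y(2) by (intro card_subset_eq)
  then show False using \<open>X \<noteq> Y\<close> by simp
qed

section \<open>Existence of minimum blocking sets\<close>

lemma finite_blocking_set_exists:
  fixes P :: "'a::euclidean_space set"
  assumes "finite P" and "DIM('a) \<ge> 2"
  shows "\<exists>Q. finite Q \<and> blocks Q P"
proof -
  let ?\<A> = "{A. A \<subseteq> P \<and> card A = DIM('a)}"
  \<comment> \<open>The relative interior is infinite: being connected, it would otherwise have at
    most one point, yet its closure contains the at least two points of \<open>A\<close>.\<close>
  have "rel_interior (convex hull A) - P \<noteq> {}" if "A \<in> ?\<A>" for A
  proof
    assume "rel_interior (convex hull A) - P = {}"
    then have fin: "finite (rel_interior (convex hull A))"
      using assms(1) by (auto intro: finite_subset)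
    have "connected (rel_interior (convex hull A))"
      by (intro convex_connected convex_rel_interior convex_convex_hull)
    from connected_finite_iff_sing[OF this] fin
    obtain x where "rel_interior (convex hull A) \<subseteq> {x}" by auto
    then have "closure (rel_interior (convex hull A)) \<subseteq> {x}"
      by (intro closure_minimal) auto
    moreover have "A \<subseteq> closure (rel_interior (convex hull A))"
      using hull_subset[of A convex] closure_subset[of "convex hull A"]
      by (simp add: convex_closure_rel_interior)
    ultimately have "A \<subseteq> {x}" by blast
    then have "card A \<le> 1"
      using card_mono[of "{x}" A] by simp
    then show False using that assms(2) by simp
  qed
  then have "\<forall>A\<in>?\<A>. \<exists>x. x \<in> rel_interior (convex hull A) - P" by blast
  from bchoice[OF this] obtain f
    where f: "\<forall>A\<in>?\<A>. f A \<in> rel_interior (convex hull A) - P" ..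
  have "finite ?\<A>" using assms(1) by simp
  then have "finite (f ` ?\<A>)" by (rule finite_imageI)
  moreover have "blocks (f ` ?\<A>) P"
    unfolding blocks_def
  proof (intro conjI allI impI)
    show "f ` ?\<A> \<inter> P = {}" using f by blast
    fix A assume "A \<subseteq> P" "card A = DIM('a)"
    then have "A \<in> ?\<A>" by simp
    then show "f ` ?\<A> \<inter> rel_interior (convex hull A) \<noteq> {}" using f by blast
  qed
  ultimately show ?thesis by blast
qed

text \<open>An infimum of natural numbers is attained once the set is nonempty. This supplies an
  actual \<open>Q\<close> for the double counting.\<close>

lemma blocking_number_attained:
  fixes P :: "'a::euclidean_space set"
  assumes "finite P" and "DIM('a) \<ge> 2"
  obtains Q where "finite Q" "blocks Q P" "card Q = blocking_number P"
proof -
  have "{card Q | Q. finite Q \<and> blocks Q P} \<noteq> {}"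
    using finite_blocking_set_exists[OF assms] by blast
  from Inf_nat_def1[OF this] show thesis
    using that by (auto simp: blocking_number_def)
qed

section \<open>A weighted family of index sets\<close>

lemma nth_sorted_list_of_set_less:
  assumes "i < j" "j < card A"
  shows "sorted_list_of_set A ! i < sorted_list_of_set A ! j"
  using sorted_wrt_nth_less[OF strict_sorted_list_of_set assms(1), of A] assms(2) by simp

lemma nth_sorted_list_of_set_image:
  assumes "finite A"
  shows "(!) (sorted_list_of_set A) ` {..<card A} = A"
  using assms nth_image[of "card A" "sorted_list_of_set A"] by (simp add: lessThan_atLeast0)

lemma strict_mono_on_image_eq_imp_eq:
  fixes f g :: "nat \<Rightarrow> 'a::linorder"
  assumes "strict_mono_on {..<m} f" "strict_mono_on {..<m} g" "f ` {..<m} = g ` {..<m}" "i < m"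
  shows "f i = g i"
proof -
  have "sorted_wrt (<) (map h [0..<m])" if "strict_mono_on {..<m} h" for h :: "nat \<Rightarrow> 'a"
    using that by (auto simp: sorted_wrt_iff_nth_less strict_mono_on_def)
  then have "map f [0..<m] = map g [0..<m]"
    using assms by (intro strict_sorted_equal) (auto simp: lessThan_atLeast0)
  then show ?thesis using \<open>i < m\<close> by simp
qed

text \<open>
  With \<open>C = {c\<^sub>0 < \<dots> < c\<^bsub>r-1\<^esub>}\<close>, the first \<open>2 * r\<close> values enumerate the pair
  \<open>{c\<^sub>0, c\<^sub>0 + l}\<close> followed by the pairs of neighbours \<open>{c\<^sub>k + l + k - 1, c\<^sub>k + l + k}\<close>, \<open>k \<ge> 1\<close>.
\<close>

definition pair_index :: "nat \<times> nat set \<Rightarrow> nat \<Rightarrow> nat" where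
  "pair_index = (\<lambda>(l, C) j.
     sorted_list_of_set C ! (j div 2) + (if j = 0 then 0 else l + (j - 1) div 2))"

text \<open>Putting back the long gap \<open>l\<close> and the \<open>r - 1\<close> unit gaps turns
  the \<open>n - l - r + 1\<close> slots for \<open>C\<close> into \<open>n\<close> positions. For
  \<open>2 * r \<le> n\<close>, the bound on \<open>l\<close> says that at least \<open>r\<close>
  slots remain.\<close>

definition pair_family :: "nat \<Rightarrow> nat \<Rightarrow> (nat \<times> nat set) set" where
  "pair_family n r = (SIGMA l:{1..n - 2 * r + 1}. {C. C \<subseteq> {..<n - l - r + 1} \<and> card C = r})"

lemma finite_pair_family: "finite (pair_family n r)"
  unfolding pair_family_def by (intro finite_SigmaI finite_Collect_conjI) auto

lemma sum_pair_family:
  "(\<Sum>x\<in>pair_family n r. 1 / real (fst x))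
    = (\<Sum>l = 1..n - 2 * r + 1. 1 / real l * real ((n - l - r + 1) choose r))"
proof -
  have "(\<Sum>x\<in>pair_family n r. 1 / real (fst x))
     = (\<Sum>l = 1..n - 2 * r + 1. \<Sum>C | C \<subseteq> {..<n - l - r + 1} \<and> card C = r. 1 / real l)"
    unfolding pair_family_def by (subst sum.Sigma) (auto simp: case_prod_unfold)
  then show ?thesis by (simp add: n_subsets)
qed

lemma strict_mono_on_pair_index:
  assumes "x \<in> pair_family n r"
  shows "strict_mono_on {..<2 * r} (pair_index x)"
proof -
  obtain l C where x: "x = (l, C)" and l: "1 \<le> l" and C: "card C = r"
    using assms by (auto simp: pair_family_def)
  have "pair_index x i < pair_index x j" if "i < j" "j < 2 * r" for i j
  proof (cases "i div 2 = j div 2")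
    case True
    \<comment> \<open>Both indices belong to one pair, whose members are \<open>l\<close> apart for
      the first pair and 1 apart for the others.\<close>
    with \<open>i < j\<close> have "even i \<and> j = i + 1" by presburger
    then obtain k where "i = 2 * k" "j = 2 * k + 1" by auto
    then show ?thesis using l by (cases k) (simp_all add: x pair_index_def)
  next
    case False
    with \<open>i < j\<close> have "i div 2 < j div 2"
      by (metis div_le_mono le_neq_implies_less less_imp_le)
    then have "sorted_list_of_set C ! (i div 2) < sorted_list_of_set C ! (j div 2)"
      using that C by (intro nth_sorted_list_of_set_less) auto
    moreover have "(i - 1) div 2 \<le> (j - 1) div 2"
      using that by (intro div_le_mono) auto
    ultimately show ?thesis using \<open>i < j\<close>
      by (cases "i = 0") (simp_all add: x pair_index_def)
  qed
  then show ?thesis by (auto simp: strict_mono_on_def)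
qed

lemma pair_index_less:
  assumes "x \<in> pair_family n r" "2 * r \<le> n" "j < 2 * r"
  shows "pair_index x j < n"
proof -
  obtain l C where x: "x = (l, C)" by (cases x)
  have l: "l \<le> n - 2 * r + 1" and C: "C \<subseteq> {..<n - l - r + 1}" "card C = r"
    using assms(1) unfolding x pair_family_def by simp_all
  have "finite C" using C(1) by (rule finite_subset) simp
  then have "(!) (sorted_list_of_set C) ` {..<r} = C"
    unfolding C(2)[symmetric] by (rule nth_sorted_list_of_set_image)
  moreover have "j div 2 \<in> {..<r}" using assms(3) by simp
  ultimately have "sorted_list_of_set C ! (j div 2) \<in> C" by blast
  with C(1) have "sorted_list_of_set C ! (j div 2) < n - l - r + 1" by blast
  moreover have "(j - 1) div 2 < r" using assms(3) by (intro less_mult_imp_div_less) simp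
  \<comment> \<open>This excludes truncated subtraction; the three summands of
    \<open>pair_index\<close> then add up to at most (n - l - r) + l + (r - 1) = n - 1.\<close>
  moreover have "l + 2 * r \<le> n + 1" using l assms(2) by simp
  moreover have "pair_index x j \<le> sorted_list_of_set C ! (j div 2) + l + (j - 1) div 2"
    by (simp add: x pair_index_def)
  ultimately show ?thesis by linarith
qed

lemma pair_index_neighbours:
  assumes "1 \<le> k"
  shows "pair_index x (2 * k + 1) = pair_index x (2 * k) + 1"
proof -
  have "Suc ((2 * k - 1) div 2) = k" using assms by presburger
  then show ?thesis using assms by (auto simp: pair_index_def split: prod.split)
qed

lemma pair_index_0_1: "pair_index x 1 = pair_index x 0 + fst x"
  by (auto simp: pair_index_def split: prod.split)

text \<open>An increasing enumeration is determined by its image. Its first two values reveal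
  \<open>l\<close>, and its values at even positions then reveal \<open>C\<close>.\<close>

lemma pair_index_image_inj:
  assumes "x \<in> pair_family n r" "y \<in> pair_family n r" "1 \<le> r"
    and "pair_index x ` {..<2 * r} = pair_index y ` {..<2 * r}"
  shows "x = y"
proof -
  obtain l C where x: "x = (l, C)" and C: "finite C" "card C = r"
    using assms(1) by (auto simp: pair_family_def intro: finite_subset)
  obtain m D where y: "y = (m, D)" and D: "finite D" "card D = r"
    using assms(2) by (auto simp: pair_family_def intro: finite_subset)
  have eq: "pair_index x j = pair_index y j" if "j < 2 * r" for j
    using strict_mono_on_image_eq_imp_eq[OF _ _ assms(4) that]
      strict_mono_on_pair_index[OF assms(1)] strict_mono_on_pair_index[OF assms(2)] by blast
  have "l = m"
    using eq[of 0] eq[of 1] pair_index_0_1[of x] pair_index_0_1[of y] assms(3)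
    by (simp add: x y)
  moreover have "sorted_list_of_set C ! k = sorted_list_of_set D ! k" if "k < r" for k
    using eq[of "2 * k"] that \<open>l = m\<close> by (simp add: x y pair_index_def split: if_splits)
  then have "C = D"
    using nth_sorted_list_of_set_image[OF C(1)] nth_sorted_list_of_set_image[OF D(1)] C(2) D(2)
    by (metis (mono_tags, lifting) image_cong lessThan_iff)
  ultimately show ?thesis by (simp add: x y)
qed

lemma prod_lessThan_double:
  fixes f :: "nat \<Rightarrow> 'a::comm_monoid_mult"
  shows "(\<Prod>j<2 * r. f j) = (\<Prod>k<r. f (2 * k) * f (2 * k + 1))"
  by (induction r) (simp_all add: mult.assoc)

text \<open>The pairs of neighbours contribute no sign, as no index lies between their members.\<close>

lemma prod_pair_index_neg_imp_between:
  fixes t :: "nat \<Rightarrow> real"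
  assumes x: "x \<in> pair_family n r" and n: "2 * r \<le> n" and "s < n"
    and t: "\<And>i j. i \<le> j \<Longrightarrow> j < n \<Longrightarrow> t i \<le> t j"
    and neg: "(\<Prod>j<2 * r. t s - t (pair_index x j)) < 0"
  shows "pair_index x 0 < s \<and> s < pair_index x 1"
proof (rule ccontr)
  assume not_between: "\<not> ?thesis"
  have "(\<Prod>j<2 * r. t s - t (pair_index x j))
      = (\<Prod>k<r. (t s - t (pair_index x (2 * k))) * (t s - t (pair_index x (2 * k + 1))))"
    by (rule prod_lessThan_double)
  also have "\<dots> \<ge> 0"
  proof (intro prod_nonneg ballI)
    fix k assume "k \<in> {..<r}"
    then have less: "pair_index x (2 * k) < n" "pair_index x (2 * k + 1) < n"
      using pair_index_less[OF x n] by auto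
    have le: "pair_index x (2 * k) \<le> pair_index x (2 * k + 1)"
      using strict_mono_on_leD[OF strict_mono_on_pair_index[OF x], of "2 * k" "2 * k + 1"]
        \<open>k \<in> {..<r}\<close> by auto
    have "s \<le> pair_index x (2 * k) \<or> pair_index x (2 * k + 1) \<le> s"
    proof (cases "k = 0")
      case True
      then show ?thesis using not_between by auto
    next
      case False
      then show ?thesis using pair_index_neighbours[of k x] by simp linarith
    qed
    then show "0 \<le> (t s - t (pair_index x (2 * k))) * (t s - t (pair_index x (2 * k + 1)))"
    proof
      assume "s \<le> pair_index x (2 * k)"
      then have "t s \<le> t (pair_index x (2 * k))" "t s \<le> t (pair_index x (2 * k + 1))"
        using less le t by auto
      then show ?thesis by (intro mult_nonpos_nonpos) auto
    next
      assume "pair_index x (2 * k + 1) \<le> s"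
      then have "t (pair_index x (2 * k)) \<le> t s" "t (pair_index x (2 * k + 1)) \<le> t s"
        using le t \<open>s < n\<close> by auto
      then show ?thesis by simp
    qed
  qed
  finally show False using neg by simp
qed

section \<open>Crossing intervals\<close>

definition crossing :: "nat \<Rightarrow> nat \<Rightarrow> nat \<Rightarrow> nat \<Rightarrow> bool" where
  "crossing a b c d \<longleftrightarrow> a < c \<and> c < b \<and> b < d \<or> c < a \<and> a < d \<and> d < b"

text \<open>No index of a set lies strictly inside its own long pair. Hence a witness inside the
  other long pair is either its own left end or at or beyond its own right end, and only the two
  interleavings are consistent.\<close>

lemma pair_index_crossing:
  assumes x: "x \<in> pair_family n r" and y: "y \<in> pair_family n r" and "1 \<le> r"
    and i: "i < 2 * r" "pair_index x 0 < pair_index y i" "pair_index y i < pair_index x 1"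
    and j: "j < 2 * r" "pair_index y 0 < pair_index x j" "pair_index x j < pair_index y 1"
  shows "crossing (pair_index x 0) (pair_index x 1) (pair_index y 0) (pair_index y 1)"
proof -
  have dichotomy: "pair_index z k = pair_index z 0 \<or> pair_index z 1 \<le> pair_index z k"
    if "z \<in> pair_family n r" "k < 2 * r" for z k
    using strict_mono_on_leD[OF strict_mono_on_pair_index[OF that(1)], of 1 k] that(2) \<open>1 \<le> r\<close>
    by (cases "k = 0") auto
  show ?thesis
    using dichotomy[OF x j(1)] dichotomy[OF y i(1)] i(2,3) j(2,3)
    unfolding crossing_def by linarith
qed

text \<open>
  Counting one endpoint of each interval inside a given one shows that every interval
  of a crossing family is at least as long as the family is large.
\<close>

lemma sum_crossing_le_1:
  fixes a b :: "'a \<Rightarrow> nat"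
  assumes "finite F" and less: "\<And>x. x \<in> F \<Longrightarrow> a x < b x"
    and cross: "\<And>x y. x \<in> F \<Longrightarrow> y \<in> F \<Longrightarrow> x \<noteq> y \<Longrightarrow> crossing (a x) (b x) (a y) (b y)"
  shows "(\<Sum>x\<in>F. 1 / real (b x - a x)) \<le> 1"
proof -
  have "card F \<le> b x - a x" if "x \<in> F" for x
  proof -
    \<comment> \<open>For \<open>y = x\<close> this is the left end, so all values fall into the
      half-open \<open>{a x..<b x}\<close>, whose size is exactly the length.\<close>
    let ?f = "\<lambda>y. if a x \<le> a y then a y else b y"
    have "inj_on ?f F"
    proof (rule inj_onI, rule ccontr)
      fix y z assume *: "y \<in> F" "z \<in> F" "?f y = ?f z" "y \<noteq> z"
      have "crossing (a y) (b y) (a z) (b z)" by (rule cross[OF *(1,2,4)])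
      \<comment> \<open>In each combination of branches an endpoint of \<open>y\<close> equals an
        endpoint of \<open>z\<close>, whereas crossing intervals have four distinct
        endpoints.\<close>
      moreover have "a x \<le> a y \<and> a x \<le> a z \<and> a y = a z \<or> a x \<le> a y \<and> a z < a x \<and> a y = b z
          \<or> a y < a x \<and> a x \<le> a z \<and> b y = a z \<or> b y = b z"
        using *(3) by (simp split: if_split_asm)
      ultimately show False
        unfolding crossing_def by linarith
    qed
    moreover have "?f y \<in> {a x..<b x}" if "y \<in> F" for y
    proof (cases "x = y")
      case True
      then show ?thesis using less[OF \<open>x \<in> F\<close>] by simp
    next
      case False
      have "crossing (a x) (b x) (a y) (b y)" by (rule cross[OF \<open>x \<in> F\<close> that False])
      then show ?thesis unfolding crossing_def by simp linarith
    qed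
    then have "?f ` F \<subseteq> {a x..<b x}" by blast
    ultimately show ?thesis
      using card_inj_on_le[of ?f F "{a x..<b x}"] by simp
  qed
  then have "(\<Sum>x\<in>F. 1 / real (b x - a x)) \<le> (\<Sum>x\<in>F. 1 / real (card F))"
    using \<open>finite F\<close> less
    by (intro sum_mono divide_left_mono) (auto simp: card_gt_0_iff intro!: mult_pos_pos)
  also have "\<dots> \<le> 1" by (cases "card F = 0") auto
  finally show ?thesis .
qed

section \<open>Double counting over a minimum blocking set\<close>

lemma blocking_number_moment_curve_ge:
  fixes P :: "(real ^ 'n::{finite,linorder}) set"
  assumes r: "r \<ge> 1" and dim: "CARD('n) = 2 * r" and n: "2 * r \<le> card P" and "finite P"
    and P: "P \<subseteq> range moment_curve"
  shows "(\<Sum>l = 1..card P - 2 * r + 1. 1 / real l * real ((card P - l - r + 1) choose r))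
    \<le> real (blocking_number P)"
proof -
  let ?\<gamma> = "moment_curve :: real \<Rightarrow> (real, 'n) vec"
  obtain T where T: "finite T" "P = ?\<gamma> ` T"
    using finite_subset_image[OF \<open>finite P\<close> P] by blast
  have "card T = card P"
    unfolding T(2) by (rule card_image[symmetric]) (rule inj_on_subset[OF inj_moment_curve], simp)
  define N where "N = card P"
  \<comment> \<open>Numbering the parameters increasingly makes the order of indices the order along
    the curve.\<close>
  define t where "t = (!) (sorted_list_of_set T)"
  have t_less: "t i < t j" if "i < j" "j < N" for i j
    using nth_sorted_list_of_set_less[of i j T] that \<open>card T = card P\<close>
    by (simp add: t_def N_def)
  then have t_le: "t i \<le> t j" if "i \<le> j" "j < N" for i j
    using that by (cases "i = j") (auto intro: less_imp_le)
  have t_inj: "inj_on t {..<N}"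
    by (rule linorder_inj_onI') (use t_less in force)
  have t_image: "t ` {..<N} = T"
    using nth_sorted_list_of_set_image[OF T(1)] \<open>card T = card P\<close> by (simp add: t_def N_def)
  define I where "I x = pair_index x ` {..<2 * r}" for x
  have I_sub: "I x \<subseteq> {..<N}" if "x \<in> pair_family N r" for x
    using pair_index_less[OF that] n by (auto simp: I_def N_def)
  have inj_index: "inj_on (pair_index x) {..<2 * r}" if "x \<in> pair_family N r" for x
    using strict_mono_on_pair_index[OF that] by (rule strict_mono_on_imp_inj_on)
  have card_tI: "card (t ` I x) = 2 * r" if "x \<in> pair_family N r" for x
    using inj_index[OF that] inj_on_subset[OF t_inj I_sub[OF that]]
    by (simp add: I_def card_image)
  define hits where
    "hits q x \<longleftrightarrow> q \<in> rel_interior (convex hull (?\<gamma> ` t ` I x))" for q x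
  have inside: "\<exists>j<2 * r. pair_index x 0 < pair_index y j \<and> pair_index y j < pair_index x 1"
    if xy: "x \<in> pair_family N r" "y \<in> pair_family N r" "x \<noteq> y" "hits q x" "hits q y" for x y q
  proof -
    have "I x \<noteq> I y"
      using pair_index_image_inj[OF xy(1,2) r] xy(3) by (auto simp: I_def)
    then have "t ` I x \<noteq> t ` I y"
      using inj_on_image_eq_iff[OF t_inj I_sub I_sub, OF xy(1,2)] by simp
    moreover have "finite (t ` I x)" "finite (t ` I y)" by (simp_all add: I_def)
    ultimately have "\<exists>v\<in>t ` I y. (\<Prod>u\<in>t ` I x. v - u) < 0"
      using xy(4,5) card_tI[OF xy(1)] card_tI[OF xy(2)] dim unfolding hits_def
      by (intro rel_interiors_meet_imp_prod_neg[of _ q]) simp_all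
    then obtain s where s: "s \<in> I y" "(\<Prod>v\<in>t ` I x. t s - v) < 0" by blast
    have "(\<Prod>v\<in>t ` I x. t s - v) = (\<Prod>j<2 * r. t s - t (pair_index x j))"
      using inj_index[OF xy(1)] inj_on_subset[OF t_inj I_sub[OF xy(1)]]
      by (simp add: I_def prod.reindex)
    moreover have "s < N" using s(1) I_sub[OF xy(2)] by auto
    ultimately have "pair_index x 0 < s \<and> s < pair_index x 1"
      using prod_pair_index_neg_imp_between[OF xy(1), of s t] n t_le s(2)
      by (auto simp: N_def)
    then show ?thesis using s(1) by (auto simp: I_def)
  qed
  have weight: "(\<Sum>x | x \<in> pair_family N r \<and> hits q x. 1 / real (fst x)) \<le> 1" for q
  proof -
    let ?F = "{x \<in> pair_family N r. hits q x}"
    have "(\<Sum>x\<in>?F. 1 / real (pair_index x 1 - pair_index x 0)) \<le> 1"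
    proof (rule sum_crossing_le_1)
      show "finite ?F" using finite_pair_family by simp
      show "pair_index x 0 < pair_index x 1" if "x \<in> ?F" for x
        using that pair_index_0_1[of x] by (auto simp: pair_family_def)
      show "crossing (pair_index x 0) (pair_index x 1) (pair_index y 0) (pair_index y 1)"
        if "x \<in> ?F" "y \<in> ?F" "x \<noteq> y" for x y
        using inside[of x y q] inside[of y x q] pair_index_crossing[of x N r y] that r by auto
    qed
    then show ?thesis unfolding pair_index_0_1 by simp
  qed
  obtain Q where Q: "finite Q" "blocks Q P" "card Q = blocking_number P"
    using blocking_number_attained[OF \<open>finite P\<close>] dim r by auto
  have hit: "\<exists>q\<in>Q. hits q x" if "x \<in> pair_family N r" for x
  proof -
    have "?\<gamma> ` t ` I x \<subseteq> P"
      using I_sub[OF that] t_image T(2) by blast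
    moreover have "card (?\<gamma> ` t ` I x) = DIM((real, 'n) vec)"
      using card_image[OF inj_on_subset[OF inj_moment_curve subset_UNIV], of "t ` I x"]
        card_tI[OF that] dim by simp
    ultimately show ?thesis
      using Q(2) unfolding blocks_def hits_def by blast
  qed
  \<comment> \<open>Every set of the family is hit by some point of \<open>Q\<close>, while each
    point collects weight at most 1. Swapping the sums therefore bounds the total weight by
    \<open>card Q\<close>.\<close>
  have "(\<Sum>x\<in>pair_family N r. 1 / real (fst x))
      \<le> (\<Sum>x\<in>pair_family N r. \<Sum>q | q \<in> Q \<and> hits q x. 1 / real (fst x))"
  proof (rule sum_mono)
    fix x assume "x \<in> pair_family N r"
    from hit[OF this] have "card {q \<in> Q. hits q x} \<ge> 1"
      using Q(1) by (auto simp: Suc_le_eq card_gt_0_iff)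
    then show "1 / real (fst x) \<le> (\<Sum>q | q \<in> Q \<and> hits q x. 1 / real (fst x))"
      by (auto simp: divide_right_mono)
  qed
  also have "\<dots> = (\<Sum>q\<in>Q. \<Sum>x | x \<in> pair_family N r \<and> hits q x. 1 / real (fst x))"
    using Q(1) finite_pair_family by (rule sum.swap_restrict[rotated])
  also have "\<dots> \<le> (\<Sum>q\<in>Q. 1)" by (intro sum_mono weight)
  finally show ?thesis
    using Q(3) by (simp add: sum_pair_family N_def)
qed

section \<open>Asymptotics\<close>

text \<open>Bernoulli's inequality for \<open>1 - y / x\<close>, scaled by
  \<open>x ^ r\<close>.\<close>

lemma power_diff_ge:
  fixes x y :: real
  assumes "0 \<le> y" "y \<le> x"
  shows "x ^ r - real r * y * x ^ (r - 1) \<le> (x - y) ^ r"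
proof (cases r)
  case (Suc m)
  show ?thesis
  proof (cases "x = 0")
    case False
    with assms have "x > 0" by simp
    have "x ^ r - real r * y * x ^ (r - 1) = x ^ r * (1 + real r * (- y / x))"
      using \<open>x > 0\<close> by (simp add: Suc field_simps)
    also have "\<dots> \<le> x ^ r * (1 + (- y / x)) ^ r"
      using assms \<open>x > 0\<close> by (intro mult_left_mono Bernoulli_inequality) auto
    also have "\<dots> = (x - y) ^ r"
      using \<open>x > 0\<close> by (simp add: field_simps flip: power_mult_distrib)
    finally show ?thesis .
  qed (use assms Suc in \<open>auto simp: power_0_left\<close>)
qed simp

text \<open>The falling factorial has \<open>r\<close> factors, the smallest being
  \<open>m - r + 1\<close>.\<close>

lemma power_le_fact_mult_choose:
  assumes "r \<le> m"
  shows "real (m - r + 1) ^ r \<le> fact r * real (m choose r)"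
proof -
  have "real (m - r + 1) ^ r = (\<Prod>i<r. real (m - r + 1))" by simp
  also have "\<dots> \<le> (\<Prod>i<r. real (m - i))"
    using assms by (intro prod_mono) auto
  also have "\<dots> = fact r * (real m gchoose r)"
    using assms by (simp add: gbinomial_mult_fact lessThan_atLeast0 of_nat_diff)
  finally show ?thesis by (simp add: binomial_gbinomial)
qed

text \<open>Each summand times \<open>fact r\<close> is \<open>n ^ r / l\<close> up to a loss of
  order \<open>n ^ (r - 1)\<close> uniform in \<open>l\<close>. The main terms form a harmonic sum
  of size at least \<open>ln n - ln r\<close>, and the at most \<open>n\<close> losses add up to
  order \<open>n ^ r\<close>.\<close>

lemma weight_sum_ge:
  assumes r: "1 \<le> r" and n: "2 * r \<le> n"
  shows "1 / fact r * real n ^ r * ln (real n)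
      - (ln (real r) + real r * (2 * real r - 1)) / fact r * real n ^ r
    \<le> (\<Sum>l = 1..n - 2 * r + 1. 1 / real l * real ((n - l - r + 1) choose r))"
proof -
  define N where "N = n - 2 * r + 1"
  \<comment> \<open>The factor \<open>r\<close> comes from Bernoulli, and \<open>2 * r - 1\<close>
    from the estimate of \<open>s\<close> by a multiple of \<open>l\<close>.\<close>
  define c where "c = real r * (2 * real r - 1)"
  have c: "0 \<le> c" using r by (simp add: c_def)
  have summand: "real n ^ r / real l - c * real n ^ (r - 1)
      \<le> fact r * (1 / real l * real ((n - l - r + 1) choose r))" if "l \<in> {1..N}" for l
  proof -
    have l: "1 \<le> l" "l + 2 * r \<le> n + 1" using that n by (auto simp: N_def)
    \<comment> \<open>Chosen so that \<open>n - s\<close> is the smallest factor of the falling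
      factorial belonging to \<open>(n - l - r + 1) choose r\<close>.\<close>
    define s where "s = real l + 2 * real r - 2"
    have s: "0 \<le> s" "s \<le> real n" "s \<le> (2 * real r - 1) * real l"
    proof -
      show "0 \<le> s" using l r by (simp add: s_def)
      show "s \<le> real n" using l by (simp add: s_def)
      have "(2 * real r - 2) * 1 \<le> (2 * real r - 2) * real l"
        using l r by (intro mult_left_mono) auto
      then show "s \<le> (2 * real r - 1) * real l" by (simp add: s_def algebra_simps)
    qed
    have "real r * s * real n ^ (r - 1) \<le> real r * ((2 * real r - 1) * real l) * real n ^ (r - 1)"
      using s by (intro mult_right_mono mult_left_mono) auto
    then have "real n ^ r - c * real l * real n ^ (r - 1) \<le> real n ^ r - real r * s * real n ^ (r - 1)"
      by (simp add: c_def mult_ac)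
    also have "\<dots> \<le> (real n - s) ^ r"
      using s by (intro power_diff_ge) auto
    also have "real n - s = real (n - l - r + 1 - r + 1)"
      using l r by (simp add: s_def of_nat_diff)
    also have "\<dots> ^ r \<le> fact r * real ((n - l - r + 1) choose r)"
      using l by (intro power_le_fact_mult_choose) auto
    finally have "(real n ^ r - c * real l * real n ^ (r - 1)) / real l
        \<le> fact r * real ((n - l - r + 1) choose r) / real l"
      by (intro divide_right_mono) auto
    then show ?thesis using l by (simp add: diff_divide_distrib)
  qed
  have "ln (real n) \<le> ln (real r * (real N + 1))"
  proof -
    \<comment> \<open>Since \<open>N + 1 = n - 2 * r + 2\<close>, this inequality is a rearrangement
      of \<open>n \<le> r * (N + 1)\<close>.\<close>
    have "(real r - 1) * (2 * real r) \<le> (real r - 1) * real n"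
      using r n by (intro mult_left_mono) auto
    then have "real n \<le> real r * (real N + 1)"
      using n by (simp add: N_def of_nat_diff algebra_simps)
    then show ?thesis using r n by (subst ln_le_cancel_iff) auto
  qed
  also have "\<dots> = ln (real r) + ln (real N + 1)"
    using r by (intro ln_mult_pos) auto
  also have "\<dots> \<le> ln (real r) + (\<Sum>l = 1..N. 1 / real l)"
    using ln_le_harm[of N] by (simp add: harm_def inverse_eq_divide)
  finally have harm: "ln (real n) - ln (real r) \<le> (\<Sum>l = 1..N. 1 / real l)" by simp
  have "real n ^ r * (ln (real n) - ln (real r)) - c * real n ^ r
      \<le> real n ^ r * (\<Sum>l = 1..N. 1 / real l) - real N * (c * real n ^ (r - 1))"
  proof (intro diff_mono mult_left_mono harm)
    have "real N * (c * real n ^ (r - 1)) \<le> real n * (c * real n ^ (r - 1))"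
      using c r n by (intro mult_right_mono) (auto simp: N_def)
    also have "\<dots> = c * real n ^ r"
      using r by (cases r) auto
    finally show "real N * (c * real n ^ (r - 1)) \<le> c * real n ^ r" .
  qed auto
  also have "\<dots> = (\<Sum>l = 1..N. real n ^ r / real l - c * real n ^ (r - 1))"
    by (simp add: sum_subtractf sum_distrib_left)
  also have "\<dots> \<le> (\<Sum>l = 1..N. fact r * (1 / real l * real ((n - l - r + 1) choose r)))"
    by (intro sum_mono summand)
  also have "\<dots> = fact r * (\<Sum>l = 1..N. 1 / real l * real ((n - l - r + 1) choose r))"
    by (simp add: sum_distrib_left)
  finally have "(real n ^ r * (ln (real n) - ln (real r)) - c * real n ^ r) / fact r
      \<le> (\<Sum>l = 1..N. 1 / real l * real ((n - l - r + 1) choose r))"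
    by (simp add: divide_le_eq mult.commute)
  then show ?thesis
    by (simp add: N_def c_def algebra_simps diff_divide_distrib add_divide_distrib)
qed

theorem theorem2:
  fixes r :: nat
  assumes "r \<ge> 1" and "CARD('n::{finite,linorder}) = 2 * r"
  shows
    "(\<forall>n P. n \<ge> 2 * r \<and> finite P \<and> card P = n \<and> P \<subseteq> range (moment_curve :: real \<Rightarrow> real ^ 'n::{finite,linorder}) \<longrightarrow>
        real (blocking_number P)
          \<ge> (\<Sum>l = 1..n - 2 * r + 1. 1 / real l * real ((n - l - r + 1) choose r))) \<and>
     (\<exists>C::real. \<forall>n P. n \<ge> 2 * r \<and> finite P \<and> card P = n \<and> P \<subseteq> range (moment_curve :: real \<Rightarrow> real ^ 'n::{finite,linorder}) \<longrightarrow>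
        (\<exists>E. \<bar>E\<bar> \<le> C * real n ^ r \<and>
          real (blocking_number P) \<ge> 1 / fact r * real n ^ r * ln (real n) - E))"
proof (rule conjI)
  show part1: "\<forall>n P. n \<ge> 2 * r \<and> finite P \<and> card P = n \<and> P \<subseteq> range (moment_curve :: real \<Rightarrow> (real, 'n) vec) \<longrightarrow>
        real (blocking_number P)
          \<ge> (\<Sum>l = 1..n - 2 * r + 1. 1 / real l * real ((n - l - r + 1) choose r))"
    using blocking_number_moment_curve_ge[OF assms] by blast
  \<comment> \<open>This constant depends on \<open>r\<close> only; the error \<open>E\<close> is
    taken to be \<open>C * n ^ r\<close> itself, so \<open>0 \<le> C\<close> makes it equal to its
    absolute value.\<close>
  define C where "C = (ln (real r) + real r * (2 * real r - 1)) / fact r"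
  have "0 \<le> C" using assms(1) by (auto simp: C_def)
  show "\<exists>C::real. \<forall>n P. n \<ge> 2 * r \<and> finite P \<and> card P = n \<and> P \<subseteq> range (moment_curve :: real \<Rightarrow> (real, 'n) vec) \<longrightarrow>
        (\<exists>E. \<bar>E\<bar> \<le> C * real n ^ r \<and>
          real (blocking_number P) \<ge> 1 / fact r * real n ^ r * ln (real n) - E)"
  proof (rule exI[of _ C], intro allI impI)
    fix n and P :: "((real, 'n) vec) set"
    assume P: "n \<ge> 2 * r \<and> finite P \<and> card P = n \<and> P \<subseteq> range moment_curve"
    have "1 / fact r * real n ^ r * ln (real n) - C * real n ^ r
        \<le> (\<Sum>l = 1..n - 2 * r + 1. 1 / real l * real ((n - l - r + 1) choose r))"
      using weight_sum_ge[OF assms(1)] P unfolding C_def by blast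
    also have "\<dots> \<le> real (blocking_number P)" using part1 P by blast
    finally have "1 / fact r * real n ^ r * ln (real n) - C * real n ^ r \<le> real (blocking_number P)" .
    then show "\<exists>E. \<bar>E\<bar> \<le> C * real n ^ r \<and>
          real (blocking_number P) \<ge> 1 / fact r * real n ^ r * ln (real n) - E"
      using \<open>0 \<le> C\<close> by (intro exI[of _ "C * real n ^ r"]) auto
  qed
qed

end
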